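(* Let $T=(V,E)$ be a decision tree with root $r$ computing a function $f:\mathcal{D}\to\Sigma_O$, $\mathcal{D}\subseteq\Sigma_I^n$, and let $w$ be a weighting scheme for $T$. Then $f$ can be computed with bounded error by a quantum query algorithm making $O(w_r)$ queries to $x$. Consequently, $\mathsf{Q}(f)\in O(\mathsf{WDT}(f))$, where $\mathsf{WDT}(f)$ is the minimum of $\mathsf{WDT}(T)$ over decision trees $T$ computing $f$.
   Context: A decision tree over finite alphabets $\Sigma_I,\Sigma_O$ is a finite rooted tree in which each internal node $v$ is labeled with an index $i_v\in[n]$, the edges from $v$ to its children $C_v$ are labeled with pairwise distinct symbols of $\Sigma_I$, and each leaf is labeled with an element of $\Sigma_O$; it computes $f$ if for every $x\in\mathcal{D}$, starting from the root and repeatedly following the edge labeled $x_{i_v}$, one reaches a leaf labeled $f(x)$. A weighting scheme for $T$ is $w:V\to\mathbb{R}_{\ge0}$ such that $w_v=0$ for all leaves and, for every internal node $v$ with children $C_v$, there exist positive semidefinite $X,Y\in\mathbb{C}^{C_v\times C_v}$ with $X[c_1,c_2]-Y[c_1,c_2]=1$ for all distinct $c_1,c_2\in C_v$ and $w_v-w_c\ge X[c,c]+Y[c,c]$ for all $c\in C_v$. $\mathsf{WDT}(T)$ is the minimum of $w_r$ over weighting schemes. $\mathsf{Q}(f)$ is the bounded-error quantum query complexity of $f$ with standard quantum query access to $x$ (e.g. $|i\rangle|b\rangle\mapsto|i\rangle|b+x_i\rangle$ with $\Sigma_I$ identified with a cyclic group). *)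

theory Defs
  imports Complex_Main
begin

text \<open>Input alphabet Sigma_I = {0..<k} (identified with the cyclic group Z_k),
  output alphabet: natural numbers. Inputs are lists of length n over {0..<k}.
  An internal node Node i cs queries index i (0-based, i < n); cs lists the children
  together with the (pairwise distinct) symbols labelling the edges to them.\<close>

datatype dtree = Leaf nat | Node nat "(nat \<times> dtree) list"

definition inputs :: "nat \<Rightarrow> nat \<Rightarrow> nat list set" where
  "inputs n k = {x. length x = n \<and> (\<forall>a\<in>set x. a < k)}"

fun wf_tree :: "nat \<Rightarrow> nat \<Rightarrow> dtree \<Rightarrow> bool" where
  "wf_tree n k (Leaf _) = True"
| "wf_tree n k (Node i cs) =
     (i < n \<and> distinct (map fst cs) \<and> (\<forall>(a, c)\<in>set cs. a < k \<and> wf_tree n k c))"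

lemma map_of_size_dtree: "map_of cs a = Some c \<Longrightarrow> size c < Suc (size_list (size_prod (\<lambda>x. 0) size) cs)"
proof (induction cs)
  case (Cons p cs) then show ?case by (cases p) (auto split: if_splits)
qed simp

function eval_tree :: "dtree \<Rightarrow> nat list \<Rightarrow> nat option" where
  "eval_tree (Leaf out) x = Some out"
| "eval_tree (Node i cs) x =
     (case map_of cs (x ! i) of None \<Rightarrow> None | Some c \<Rightarrow> eval_tree c x)"
  by pat_completeness auto
termination by (relation "measure (size \<circ> fst)") (auto dest: map_of_size_dtree)

definition computes :: "dtree \<Rightarrow> nat list set \<Rightarrow> (nat list \<Rightarrow> nat) \<Rightarrow> bool" where
  "computes T D f \<longleftrightarrow> (\<forall>x\<in>D. eval_tree T x = Some (f x))"

text \<open>Nodes of a tree are identified with their paths from the root (lists of edge labels).\<close>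

function subtree :: "dtree \<Rightarrow> nat list \<Rightarrow> dtree option" where
  "subtree T [] = Some T"
| "subtree (Leaf _) (a # p) = None"
| "subtree (Node i cs) (a # p) =
     (case map_of cs a of None \<Rightarrow> None | Some c \<Rightarrow> subtree c p)"
  by pat_completeness auto
termination by (relation "measure (size \<circ> fst)") (auto dest: map_of_size_dtree)

definition psd :: "nat \<Rightarrow> (nat \<Rightarrow> nat \<Rightarrow> complex) \<Rightarrow> bool" where
  "psd m X \<longleftrightarrow> (\<forall>i<m. \<forall>j<m. X i j = cnj (X j i)) \<and>
     (\<forall>v :: nat \<Rightarrow> complex. 0 \<le> Re (\<Sum>i<m. \<Sum>j<m. cnj (v i) * X i j * v j))"

definition weighting_scheme :: "dtree \<Rightarrow> (nat list \<Rightarrow> real) \<Rightarrow> bool" where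
  "weighting_scheme T w \<longleftrightarrow>
     (\<forall>p. subtree T p \<noteq> None \<longrightarrow> 0 \<le> w p) \<and>
     (\<forall>p out. subtree T p = Some (Leaf out) \<longrightarrow> w p = 0) \<and>
     (\<forall>p i cs. subtree T p = Some (Node i cs) \<longrightarrow>
        (\<exists>X Y. psd (length cs) X \<and> psd (length cs) Y \<and>
           (\<forall>j1<length cs. \<forall>j2<length cs. j1 \<noteq> j2 \<longrightarrow> X j1 j2 - Y j1 j2 = 1) \<and>
           (\<forall>j<length cs. w p - w (p @ [fst (cs ! j)]) \<ge> Re (X j j + Y j j))))"

definition WDT_tree :: "dtree \<Rightarrow> real" where
  "WDT_tree T = Inf {w [] | w. weighting_scheme T w}"

definition WDT :: "nat \<Rightarrow> nat \<Rightarrow> nat list set \<Rightarrow> (nat list \<Rightarrow> nat) \<Rightarrow> real" where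
  "WDT n k D f = Inf {WDT_tree T | T. wf_tree n k T \<and> computes T D f}"

text \<open>Finite-dimensional state space C^N, N = n * k * m: query register (index i < n, symbol
  b < k) tensor workspace (w < m); basis index of |i,b,w> is (i*k + b)*m + w.
  Square matrices of dimension N are functions nat => nat => complex (entries outside N ignored).\<close>

definition unitary :: "nat \<Rightarrow> (nat \<Rightarrow> nat \<Rightarrow> complex) \<Rightarrow> bool" where
  "unitary N U \<longleftrightarrow> (\<forall>i<N. \<forall>j<N. (\<Sum>l<N. U i l * cnj (U j l)) = (if i = j then 1 else 0))"

definition mat_vec :: "nat \<Rightarrow> (nat \<Rightarrow> nat \<Rightarrow> complex) \<Rightarrow> (nat \<Rightarrow> complex) \<Rightarrow> (nat \<Rightarrow> complex)" where
  "mat_vec N U v = (\<lambda>i. if i < N then (\<Sum>j<N. U i j * v j) else 0)"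

text \<open>Standard query operator |i,b,w> |-> |i, b + x_i mod k, w>.\<close>

definition query_perm :: "nat \<Rightarrow> nat \<Rightarrow> nat list \<Rightarrow> nat \<Rightarrow> nat" where
  "query_perm k m x c =
     (let i = c div (k * m); b = (c div m) mod k; w = c mod m
      in (i * k + (b + x ! i) mod k) * m + w)"

definition query_op :: "nat \<Rightarrow> nat \<Rightarrow> nat \<Rightarrow> nat list \<Rightarrow> (nat \<Rightarrow> nat \<Rightarrow> complex)" where
  "query_op n k m x = (\<lambda>r c. if r = query_perm k m x c then 1 else 0)"

text \<open>An algorithm U_0, O_x, U_1, O_x, ..., O_x, U_t makes t queries.\<close>

fun run :: "nat \<Rightarrow> (nat \<Rightarrow> nat \<Rightarrow> complex) \<Rightarrow> (nat \<Rightarrow> nat \<Rightarrow> complex) list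
             \<Rightarrow> (nat \<Rightarrow> complex) \<Rightarrow> (nat \<Rightarrow> complex)" where
  "run N Ox [] v = v"
| "run N Ox [U] v = mat_vec N U v"
| "run N Ox (U # U' # Us) v = run N Ox (U' # Us) (mat_vec N Ox (mat_vec N U v))"

definition init_state :: "nat \<Rightarrow> complex" where
  "init_state = (\<lambda>i. if i = 0 then 1 else 0)"

text \<open>Final measurement in the computational basis; basis state j yields output g j.\<close>

definition success_prob ::
  "nat \<Rightarrow> nat \<Rightarrow> nat \<Rightarrow> (nat \<Rightarrow> nat \<Rightarrow> complex) list \<Rightarrow> (nat \<Rightarrow> nat) \<Rightarrow> nat list \<Rightarrow> nat \<Rightarrow> real" where
  "success_prob n k m Us g x y =
     (let N = n * k * m; \<psi> = run N (query_op n k m x) Us init_state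
      in (\<Sum>j | j < N \<and> g j = y. (cmod (\<psi> j))\<^sup>2))"

definition quantum_computes :: "nat \<Rightarrow> nat \<Rightarrow> nat list set \<Rightarrow> (nat list \<Rightarrow> nat) \<Rightarrow> nat \<Rightarrow> bool" where
  "quantum_computes n k D f t \<longleftrightarrow>
     (\<exists>m Us g. m \<ge> 1 \<and> length Us = t + 1 \<and> (\<forall>U\<in>set Us. unitary (n * k * m) U) \<and>
        (\<forall>x\<in>D. success_prob n k m Us g x (f x) \<ge> 2 / 3))"

definition Q :: "nat \<Rightarrow> nat \<Rightarrow> nat list set \<Rightarrow> (nat list \<Rightarrow> nat) \<Rightarrow> nat" where
  "Q n k D f = (LEAST t. quantum_computes n k D f t)"

end

theory Submission
  imports Defs "HOL-Library.Nat_Bijection"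
begin

text \<open>Attach to every input $x$ a vector $v_x$ (the catalyst) with $\|v_x\|^2 \le w_r$ and
  $\langle v_x, v_y\rangle - \langle O_x v_x, O_y v_y\rangle = 1 - [leaf(x) = leaf(y)]$:
  at each node on the path of $x$, continuing to child $c$, write $X$ and $Y$ as Gram matrices of
  vectors $a_c$ and $b_c$, and put $a_c$ next to the symbol $0$ and $b_c$ next to the symbol $-x_i$
  in the query register. Divergence of two paths at a node contributes $X[c,c'] - Y[c,c'] = 1$, all
  other nodes contribute nothing, and the norms telescope to at most $w_r$.

  Let the ideal state before query $j + 1$ be
  $\phi_{x,j} = K^{-1/2} (\sqrt{K-j}\, e_* + \sqrt j\, e_{leaf(x)} + v_x)$, where $e_*$ and the
  $e_{leaf}$ are invariant under queries. By the identity above the families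
  $O_x \phi_{x,j}$ and $\phi_{x,j+1}$ have the same Gram matrix, so one unitary independent of $x$
  maps the former to the latter. The algorithm starts in $e_*$ instead of $\phi_{x,0}$; this error
  has norm $\|v_x\| / \sqrt K$ and does not grow, so $K = O(w_r)$ queries suffice.\<close>

section \<open>Extending isometries to unitaries\<close>

definition ip :: "nat \<Rightarrow> (nat \<Rightarrow> complex) \<Rightarrow> (nat \<Rightarrow> complex) \<Rightarrow> complex" where
  "ip N u v = (\<Sum>i<N. cnj (u i) * v i)"

lemma ip_cong:
  assumes "\<And>i. i < N \<Longrightarrow> u i = u' i" "\<And>i. i < N \<Longrightarrow> v i = v' i"
  shows "ip N u v = ip N u' v'"
  unfolding ip_def by (rule sum.cong) (auto simp: assms)

lemma ip_cnj: "cnj (ip N u v) = ip N v u"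
  by (simp add: ip_def mult.commute)

lemma ip_diff_left: "ip N (\<lambda>i. u i - u' i) v = ip N u v - ip N u' v"
  by (simp add: ip_def left_diff_distrib sum_subtractf)

lemma ip_diff_right: "ip N u (\<lambda>i. v i - v' i) = ip N u v - ip N u v'"
  by (simp add: ip_def right_diff_distrib sum_subtractf)

lemma ip_scale_left: "ip N (\<lambda>i. u i * a) v = cnj a * ip N u v"
  by (simp add: ip_def sum_distrib_left mult_ac)

lemma ip_scale_right: "ip N u (\<lambda>i. v i * a) = a * ip N u v"
  by (simp add: ip_def sum_distrib_left mult_ac)

lemma ip_self: "ip N u u = of_real (\<Sum>i<N. (cmod (u i))\<^sup>2)"
  by (simp only: ip_def of_real_sum complex_norm_square mult.commute)

lemma ip_self_eq_0D:
  assumes "ip N u u = 0" "i < N"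
  shows "u i = 0"
proof -
  have "(\<Sum>i<N. (cmod (u i))\<^sup>2) = 0"
    using assms(1) unfolding ip_self by (simp only: of_real_eq_0_iff)
  then show ?thesis
    using assms(2) by (subst (asm) sum_nonneg_eq_0_iff) auto
qed

lemma mat_vec_diff: "mat_vec N U (\<lambda>i. u i - v i) = (\<lambda>i. mat_vec N U u i - mat_vec N U v i)"
  by (rule ext) (simp add: mat_vec_def right_diff_distrib sum_subtractf)

lemma mat_vec_cong: "(\<And>i. i < N \<Longrightarrow> u i = v i) \<Longrightarrow> mat_vec N U u = mat_vec N U v"
  unfolding mat_vec_def by (rule ext) simp

definition identity :: "nat \<Rightarrow> nat \<Rightarrow> complex" where
  "identity i j = (if i = j then 1 else 0)"

lemma mat_vec_identity: "i < N \<Longrightarrow> mat_vec N identity v i = v i"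
  by (simp add: mat_vec_def identity_def if_distrib[where f="\<lambda>a. a * _"] cong: if_cong)

lemma unitary_identity: "unitary N identity"
  by (simp add: unitary_def identity_def if_distrib[where f="\<lambda>a. a * _"] cong: if_cong)

text \<open>The extension of the partial isometry is built one vector at a time: if $r$ is the image of
  the new vector under the unitary found so far and $q$ its prescribed image, then with $u = r - q$
  and $z = \langle u, r\rangle$ the complex Householder map $1 - u u^*/z$ sends $r$ to $q$ and fixes
  all vectors that $r$ and $q$ have the same inner product with. It is unitary because
  $\|u\|^2 = z + \bar z$.\<close>

lemma unitary_extension:
  assumes "finite D"
    and "\<And>x y. x \<in> D \<Longrightarrow> y \<in> D \<Longrightarrow> ip N (p x) (p y) = ip N (q x) (q y)"
  shows "\<exists>U. unitary N U \<and> (\<forall>u v. ip N (mat_vec N U u) (mat_vec N U v) = ip N u v) \<and>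
    (\<forall>x\<in>D. \<forall>i<N. mat_vec N U (p x) i = q x i)"
  using assms
proof (induction D)
  case empty
  have "ip N (mat_vec N identity u) (mat_vec N identity v) = ip N u v" for u v
    by (rule ip_cong) (simp_all add: mat_vec_identity)
  then show ?case using unitary_identity by (intro exI[of _ identity]) simp
next
  case (insert x F)
  obtain U where U: "unitary N U"
    and iso: "\<And>u v. ip N (mat_vec N U u) (mat_vec N U v) = ip N u v"
    and maps: "\<And>y i. y \<in> F \<Longrightarrow> i < N \<Longrightarrow> mat_vec N U (p y) i = q y i"
    using insert.IH[OF insert.prems] by auto
  define r where "r = mat_vec N U (p x)"
  define u where "u = (\<lambda>i. r i - q x i)"
  define z where "z = ip N u r"
  have rr: "ip N r r = ip N (q x) (q x)"
    unfolding r_def iso using insert.prems by simp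
  have "cnj z = ip N r r - ip N r (q x)"
    by (simp add: z_def u_def ip_cnj ip_diff_right)
  then have uu: "ip N u u = z + cnj z"
    by (simp add: z_def u_def ip_diff_left ip_diff_right rr)
  have fixes_q: "ip N u (q y) = 0" if "y \<in> F" for y
  proof -
    have "ip N r (q y) = ip N r (mat_vec N U (p y))"
      using that maps by (intro ip_cong) auto
    also have "\<dots> = ip N (q x) (q y)"
      unfolding r_def iso using insert.prems that by simp
    finally show ?thesis by (simp add: u_def ip_diff_left)
  qed
  show ?case
  proof (cases "z = 0")
    \<comment> \<open>Now \<open>u\<close> has norm 0, so \<open>r\<close> already equals its target
      and \<open>U\<close> serves unchanged; the Householder map would divide by 0.\<close>
    case True
    then have "u i = 0" if "i < N" for i
      using ip_self_eq_0D[OF _ that] uu by simp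
    then have "mat_vec N U (p x) i = q x i" if "i < N" for i
      using that by (auto simp: u_def r_def)
    then have "\<forall>y\<in>insert x F. \<forall>i<N. mat_vec N U (p y) i = q y i"
      using maps by auto
    then show ?thesis using U iso by (intro exI[of _ U]) simp
  next
    case z: False
    \<comment> \<open>\<open>s\<close> is the row vector u^* U, so \<open>U'\<close> is the
      Householder map times \<open>U\<close>.\<close>
    define s where "s l = (\<Sum>k<N. cnj (u k) * U k l)" for l
    define U' where "U' i j = U i j - u i * s j / z" for i j
    have mv: "mat_vec N U' v i = mat_vec N U v i - u i * (ip N u (mat_vec N U v) / z)"
      if "i < N" for v i
    proof -
      have "(\<Sum>j<N. s j * v j) = ip N u (mat_vec N U v)"
        unfolding s_def ip_def mat_vec_def sum_distrib_right
        by (subst sum.swap) (simp add: sum_distrib_left mult_ac)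
      then have "(\<Sum>j<N. (u i * s j / z) * v j) = u i * (ip N u (mat_vec N U v) / z)"
        by (simp flip: sum_distrib_left sum_divide_distrib add: mult.assoc)
      then show ?thesis
        using that by (simp add: mat_vec_def U'_def left_diff_distrib sum_subtractf)
    qed
    \<comment> \<open>\<open>unitary\<close> asserts orthonormal rows, U U^* = 1, while the
      induction and the error analysis need U^* U = 1. Both are carried through the induction and
      checked separately.\<close>
    have iso': "ip N (mat_vec N U' a) (mat_vec N U' b) = ip N a b" for a b
    proof -
      define a' b' where "a' = mat_vec N U a" and "b' = mat_vec N U b"
      have "ip N (mat_vec N U' a) (mat_vec N U' b) =
        ip N (\<lambda>i. a' i - u i * (ip N u a' / z)) (\<lambda>i. b' i - u i * (ip N u b' / z))"
        by (rule ip_cong) (simp_all add: mv a'_def b'_def)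
      also have "\<dots> = ip N a' b' - ip N u b' / z * ip N a' u
          - cnj (ip N u a') / cnj z * (ip N u b' - ip N u b' / z * (z + cnj z))"
        unfolding ip_diff_left ip_diff_right ip_scale_left ip_scale_right uu
        by (simp add: algebra_simps)
      also have "\<dots> = ip N a' b'"
        using z by (simp add: ip_cnj field_simps)
      finally show ?thesis by (simp add: a'_def b'_def iso)
    qed
    have UU: "(\<Sum>l<N. U i l * cnj (U j l)) = (if i = j then 1 else 0)" if "i < N" "j < N" for i j
      using U that by (simp add: unitary_def)
    have Us: "(\<Sum>l<N. U i l * cnj (s l)) = u i" if "i < N" for i
    proof -
      have "(\<Sum>l<N. U i l * cnj (s l)) = (\<Sum>k<N. u k * (\<Sum>l<N. U i l * cnj (U k l)))"
        unfolding s_def cnj_sum sum_distrib_left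
        by (subst sum.swap) (simp add: mult_ac)
      also have "\<dots> = (\<Sum>k<N. if i = k then u k else 0)"
        by (rule sum.cong) (auto simp: UU that)
      finally show ?thesis using that by simp
    qed
    have sU: "(\<Sum>l<N. s l * cnj (U i l)) = cnj (u i)" if "i < N" for i
      using arg_cong[OF Us[OF that], of cnj] by (simp add: mult.commute)
    have ss: "(\<Sum>l<N. s l * cnj (s l)) = z + cnj z"
    proof -
      have "(\<Sum>l<N. s l * cnj (s l)) = (\<Sum>l<N. \<Sum>k<N. cnj (u k) * (U k l * cnj (s l)))"
        by (subst (1) s_def) (simp add: sum_distrib_left mult_ac)
      also have "\<dots> = (\<Sum>k<N. cnj (u k) * (\<Sum>l<N. U k l * cnj (s l)))"
        by (subst sum.swap) (simp add: sum_distrib_left)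
      also have "\<dots> = ip N u u" unfolding ip_def by (rule sum.cong) (auto simp: Us)
      finally show ?thesis by (simp add: uu)
    qed
    have "unitary N U'"
      unfolding unitary_def
    proof (intro allI impI)
      fix i j assume ij: "i < N" "j < N"
      have "(\<Sum>l<N. U' i l * cnj (U' j l)) =
        (\<Sum>l<N. U i l * cnj (U j l) - cnj (u j) / cnj z * (U i l * cnj (s l))
          - u i / z * (s l * cnj (U j l)) + u i * cnj (u j) / (z * cnj z) * (s l * cnj (s l)))"
        by (rule sum.cong) (auto simp: U'_def algebra_simps)
      also have "\<dots> = (\<Sum>l<N. U i l * cnj (U j l)) - cnj (u j) / cnj z * u i
          - u i / z * cnj (u j) + u i * cnj (u j) / (z * cnj z) * (z + cnj z)"
        unfolding sum.distrib sum_subtractf sum_distrib_left[symmetric]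
        using ij by (simp add: Us sU ss)
      also have "\<dots> = (\<Sum>l<N. U i l * cnj (U j l))"
        using z by (simp add: field_simps)
      finally show "(\<Sum>l<N. U' i l * cnj (U' j l)) = (if i = j then 1 else 0)"
        using UU ij by simp
    qed
    \<comment> \<open>On \<open>r\<close> the correction is u z / z = u, and r - u is the
      target.\<close>
    moreover have "mat_vec N U' (p x) i = q x i" if "i < N" for i
      using that z by (simp add: mv flip: r_def z_def) (simp add: u_def)
    moreover have "mat_vec N U' (p y) i = q y i" if "i < N" "y \<in> F" for i y
    proof -
      have "ip N u (mat_vec N U (p y)) = ip N u (q y)"
        using that maps by (intro ip_cong) auto
      then show ?thesis using that by (simp add: mv maps fixes_q)
    qed
    ultimately have "unitary N U'" "\<forall>y\<in>insert x F. \<forall>i<N. mat_vec N U' (p y) i = q y i"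
      by auto
    then show ?thesis using iso' by (intro exI[of _ U']) simp
  qed
qed

section \<open>Positive semidefinite kernels\<close>

text \<open>The kernels live on sets of inputs, and the tree induction restricts them to the inputs
  entering one branch, hence arbitrary index sets.\<close>

definition psd_on :: "'a set \<Rightarrow> ('a \<Rightarrow> 'a \<Rightarrow> complex) \<Rightarrow> bool" where
  "psd_on S A \<longleftrightarrow> (\<forall>x\<in>S. \<forall>y\<in>S. A x y = cnj (A y x)) \<and>
     (\<forall>v. 0 \<le> Re (\<Sum>x\<in>S. \<Sum>y\<in>S. cnj (v x) * A x y * v y))"

lemma psd_onI:
  assumes "\<And>x y. x \<in> S \<Longrightarrow> y \<in> S \<Longrightarrow> A x y = cnj (A y x)"
    "\<And>v. 0 \<le> Re (\<Sum>x\<in>S. \<Sum>y\<in>S. cnj (v x) * A x y * v y)"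
  shows "psd_on S A"
  using assms unfolding psd_on_def by blast

lemma psd_on_cnj: "psd_on S A \<Longrightarrow> x \<in> S \<Longrightarrow> y \<in> S \<Longrightarrow> A x y = cnj (A y x)"
  unfolding psd_on_def by blast

lemma psd_on_nonneg: "psd_on S A \<Longrightarrow> 0 \<le> Re (\<Sum>x\<in>S. \<Sum>y\<in>S. cnj (v x) * A x y * v y)"
  unfolding psd_on_def by blast

lemma psd_on_lessThan: "psd m X \<longleftrightarrow> psd_on {..<m} X"
  unfolding psd_def psd_on_def by (simp add: Ball_def)

lemma psd_on_subset:
  fixes S :: "'a set"
  assumes "psd_on S A" "finite S" "F \<subseteq> S"
  shows "psd_on F A"
proof (rule psd_onI)
  fix v :: "'a \<Rightarrow> complex"
  let ?v = "\<lambda>x. if x \<in> F then v x else 0"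
  have "(\<Sum>x\<in>S. \<Sum>y\<in>S. cnj (?v x) * A x y * ?v y) = (\<Sum>x\<in>S. \<Sum>y\<in>F. cnj (?v x) * A x y * ?v y)"
    using assms by (intro sum.cong refl sum.mono_neutral_right) auto
  also have "\<dots> = (\<Sum>x\<in>F. \<Sum>y\<in>F. cnj (?v x) * A x y * ?v y)"
    using assms by (intro sum.mono_neutral_right) auto
  also have "\<dots> = (\<Sum>x\<in>F. \<Sum>y\<in>F. cnj (v x) * A x y * v y)"
    by (intro sum.cong) auto
  finally show "0 \<le> Re (\<Sum>x\<in>F. \<Sum>y\<in>F. cnj (v x) * A x y * v y)"
    using psd_on_nonneg[OF assms(1), of ?v] by simp
next
  fix x y assume "x \<in> F" "y \<in> F"
  then show "A x y = cnj (A y x)" using assms(3) psd_on_cnj[OF assms(1)] by blast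
qed

lemma psd_on_add:
  fixes S :: "'a set"
  assumes "psd_on S A" "psd_on S B"
  shows "psd_on S (\<lambda>x y. A x y + B x y)"
proof (rule psd_onI)
  fix v :: "'a \<Rightarrow> complex"
  show "0 \<le> Re (\<Sum>x\<in>S. \<Sum>y\<in>S. cnj (v x) * (A x y + B x y) * v y)"
    using psd_on_nonneg[OF assms(1), of v] psd_on_nonneg[OF assms(2), of v]
    by (simp add: distrib_left distrib_right sum.distrib)
next
  fix x y assume "x \<in> S" "y \<in> S"
  then show "A x y + B x y = cnj (A y x + B y x)"
    using psd_on_cnj[OF assms(1), of x y] psd_on_cnj[OF assms(2), of x y] by simp
qed

lemma psd_on_zero: "psd_on S (\<lambda>x y. 0)"
  by (rule psd_onI) auto

text \<open>The form at \<open>v\<close> is the form of \<open>X\<close> at the pushforward of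
  \<open>v\<close>, whose entry at \<open>r\<close> sums \<open>v\<close> over the fibre of
  \<open>h\<close>.\<close>

lemma psd_on_pullback:
  fixes h :: "'a \<Rightarrow> 'b"
  assumes "psd_on R X" "finite R" "finite S" "h ` S \<subseteq> R"
  shows "psd_on S (\<lambda>x y. X (h x) (h y))"
proof (rule psd_onI)
  fix v :: "'a \<Rightarrow> complex"
  let ?v = "\<lambda>r. \<Sum>x | x \<in> S \<and> h x = r. v x"
  have "(\<Sum>r\<in>R. \<Sum>s\<in>R. cnj (?v r) * X r s * ?v s) =
    (\<Sum>r\<in>R. \<Sum>s\<in>R. \<Sum>x | x \<in> S \<and> h x = r. \<Sum>y | y \<in> S \<and> h y = s. cnj (v x) * X (h x) (h y) * v y)"
  proof (intro sum.cong refl)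
    fix r s
    have "cnj (?v r) * X r s * ?v s =
      (\<Sum>x | x \<in> S \<and> h x = r. \<Sum>y | y \<in> S \<and> h y = s. cnj (v x) * X r s * v y)"
      by (subst sum.swap) (simp only: cnj_sum sum_distrib_left sum_distrib_right)
    also have "\<dots> = (\<Sum>x | x \<in> S \<and> h x = r. \<Sum>y | y \<in> S \<and> h y = s. cnj (v x) * X (h x) (h y) * v y)"
      by (intro sum.cong) auto
    finally show "cnj (?v r) * X r s * ?v s = \<dots>" .
  qed
  also have "\<dots> = (\<Sum>r\<in>R. \<Sum>x | x \<in> S \<and> h x = r. \<Sum>y\<in>S. cnj (v x) * X (h x) (h y) * v y)"
  proof (rule sum.cong[OF refl])
    fix r
    show "(\<Sum>s\<in>R. \<Sum>x | x \<in> S \<and> h x = r. \<Sum>y | y \<in> S \<and> h y = s. cnj (v x) * X (h x) (h y) * v y) =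
      (\<Sum>x | x \<in> S \<and> h x = r. \<Sum>y\<in>S. cnj (v x) * X (h x) (h y) * v y)"
      by (subst sum.swap) (intro sum.cong refl sum.group assms)
  qed
  also have "\<dots> = (\<Sum>x\<in>S. \<Sum>y\<in>S. cnj (v x) * X (h x) (h y) * v y)"
    by (intro sum.group assms)
  finally show "0 \<le> Re (\<Sum>x\<in>S. \<Sum>y\<in>S. cnj (v x) * X (h x) (h y) * v y)"
    using psd_on_nonneg[OF assms(1), of ?v] by simp
next
  fix x y assume "x \<in> S" "y \<in> S"
  then show "X (h x) (h y) = cnj (X (h y) (h x))" using assms(4) psd_on_cnj[OF assms(1)] by blast
qed

text \<open>Terms with different values of \<open>h\<close> vanish, so the form splits into one
  nonnegative form per fibre.\<close>

lemma psd_on_block_diagonal: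
  fixes S :: "'a set"
  assumes "finite S" and "\<And>a. psd_on {x \<in> S. h x = a} (B a)"
  shows "psd_on S (\<lambda>x y. if h x = h y then B (h x) x y else 0)"
proof (rule psd_onI)
  fix v :: "'a \<Rightarrow> complex"
  let ?F = "\<lambda>x y. cnj (v x) * (if h x = h y then B (h x) x y else 0) * v y"
  have "(\<Sum>x\<in>S. \<Sum>y\<in>S. ?F x y) = (\<Sum>a\<in>h ` S. \<Sum>x | x \<in> S \<and> h x = a. \<Sum>y\<in>S. ?F x y)"
    using assms(1) by (intro sum.group[symmetric]) auto
  also have "\<dots> = (\<Sum>a\<in>h ` S. \<Sum>x\<in>{x \<in> S. h x = a}. \<Sum>y\<in>{x \<in> S. h x = a}. cnj (v x) * B a x y * v y)"
    using assms(1) by (intro sum.cong refl sum.mono_neutral_cong_right) auto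
  finally show "0 \<le> Re (\<Sum>x\<in>S. \<Sum>y\<in>S. ?F x y)"
    using psd_on_nonneg[OF assms(2), of v] by (simp add: sum_nonneg)
next
  fix x y assume "x \<in> S" "y \<in> S"
  then show "(if h x = h y then B (h x) x y else 0) = cnj (if h y = h x then B (h y) y x else 0)"
    using psd_on_cnj[OF assms(2), of x "h x" y] by auto
qed

lemma psd_on_two:
  assumes "psd_on S A" "finite S" "x \<in> S" "y \<in> S" "x \<noteq> y"
  shows "0 \<le> Re (cnj a * A x x * a + cnj a * A x y * b + cnj b * A y x * a + cnj b * A y y * b)"
proof -
  have "psd_on {x, y} A" using assms by (intro psd_on_subset[OF assms(1,2)]) auto
  from psd_on_nonneg[OF this, of "\<lambda>z. if z = x then a else b"] show ?thesis
    using assms(5) by (simp add: algebra_simps)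
qed

lemma psd_on_diag:
  assumes "psd_on S A" "finite S" "x \<in> S"
  shows "A x x = of_real (Re (A x x))" "0 \<le> Re (A x x)"
proof -
  have "psd_on {x} A" using assms by (intro psd_on_subset[OF assms(1,2)]) auto
  from psd_on_nonneg[OF this, of "\<lambda>_. 1"] show "0 \<le> Re (A x x)" by simp
  show "A x x = of_real (Re (A x x))"
    using psd_on_cnj[OF assms(1,3,3)] by (simp add: complex_eq_iff)
qed

text \<open>With a zero at \<open>z\<close> on the diagonal, the form at the vector with entry 1 at
  \<open>x\<close> and - s A z x at \<open>z\<close> is linear in \<open>s\<close> with slope - 2 |A
  z x|^2, hence eventually negative unless \<open>A z x\<close> vanishes.\<close>

lemma psd_on_zero_diag:
  assumes "psd_on S A" "finite S" "x \<in> S" "z \<in> S" "x \<noteq> z" "A z z = 0"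
  shows "A z x = 0"
proof (rule ccontr)
  define t where "t = cmod (A z x)"
  \<comment> \<open>Chosen so that the form takes the value -1.\<close>
  define s where "s = (Re (A x x) + 1) / (2 * t\<^sup>2)"
  assume "A z x \<noteq> 0"
  then have t: "t > 0" by (simp add: t_def)
  have xz: "A x z = cnj (A z x)" using psd_on_cnj[OF assms(1,3,4)] .
  have "A z x * cnj (A z x) = of_real (t\<^sup>2)"
    by (simp only: t_def complex_norm_square)
  then have "Re (A x x + cnj (A z x) * (- of_real s * A z x)
      + cnj (- of_real s * A z x) * A z x) = Re (A x x) - 2 * s * t\<^sup>2"
    by (simp add: algebra_simps flip: of_real_mult)
  also have "\<dots> = -1" using t by (simp add: s_def field_simps)
  finally show False
    using psd_on_two[OF assms(1-5), of 1 "- of_real s * A z x"] assms(6) xz by simp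
qed

text \<open>Cholesky factorisation. When the pivot \<open>A z z\<close> vanishes, division by zero makes the
  correction terms vanish too, which is right since then the whole row is zero.\<close>

lemma psd_on_gram:
  assumes "finite S" "psd_on S A"
  shows "\<exists>V :: 'a \<Rightarrow> nat \<Rightarrow> complex. \<forall>x\<in>S. \<forall>y\<in>S. A x y = ip (card S) (V x) (V y)"
  using assms
proof (induction S arbitrary: A)
  case empty
  show ?case by simp
next
  case (insert z S)
  define d where "d = Re (A z z)"
  have fin: "finite (insert z S)" using insert.hyps by simp
  have d: "A z z = of_real d" "d \<ge> 0"
    using psd_on_diag[OF insert.prems fin, of z] by (simp_all add: d_def)
  have sym: "A x y = cnj (A y x)" if "x \<in> insert z S" "y \<in> insert z S" for x y
    using psd_on_cnj[OF insert.prems that] .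
  have row0: "A z x = 0" if "d = 0" "x \<in> S" for x
    using psd_on_zero_diag[OF insert.prems fin, of x z] that d insert.hyps by auto
  \<comment> \<open>The Schur complement of the pivot, on which the induction continues.\<close>
  define B where "B x y = A x y - A x z * A z y / of_real d" for x y
  have "psd_on S B"
  proof (rule psd_onI)
    fix x y assume "x \<in> S" "y \<in> S"
    then show "B x y = cnj (B y x)"
      using sym[of x y] sym[of x z] sym[of z y] by (simp add: B_def)
  next
    fix v :: "'a \<Rightarrow> complex"
    define a where "a = (\<Sum>y\<in>S. A z y * v y)"
    \<comment> \<open>The entry at \<open>z\<close> completes the square, so the form of
      \<open>A\<close> at \<open>v'\<close> is the form of \<open>B\<close> at \<open>v\<close>; for
      d = 0 it is 0.\<close>
    define v' where "v' = v(z := - a / of_real d)"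
    have v': "v' x = v x" if "x \<in> S" for x using that insert.hyps by (auto simp: v'_def)
    have ca: "(\<Sum>x\<in>S. cnj (v x) * A x z) = cnj a"
      unfolding a_def cnj_sum
    proof (rule sum.cong[OF refl])
      fix x assume "x \<in> S"
      then show "cnj (v x) * A x z = cnj (A z x * v x)"
        using sym[of x z] by simp
    qed
    have "(\<Sum>x\<in>insert z S. \<Sum>y\<in>insert z S. cnj (v' x) * A x y * v' y) =
      cnj (v' z) * A z z * v' z + cnj (v' z) * (\<Sum>y\<in>S. A z y * v' y)
      + (\<Sum>x\<in>S. cnj (v' x) * A x z) * v' z + (\<Sum>x\<in>S. \<Sum>y\<in>S. cnj (v' x) * A x y * v' y)"
      using insert.hyps
      by (simp add: sum.distrib sum_distrib_left sum_distrib_right mult.assoc)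
    also have "\<dots> = cnj (v' z) * A z z * v' z + cnj (v' z) * a + cnj a * v' z
        + (\<Sum>x\<in>S. \<Sum>y\<in>S. cnj (v x) * A x y * v y)"
      unfolding ca[symmetric] unfolding a_def by (simp add: v' cong: sum.cong)
    also have "\<dots> = (\<Sum>x\<in>S. \<Sum>y\<in>S. cnj (v x) * A x y * v y) - cnj a * a / of_real d"
      by (cases "d = 0") (simp_all add: v'_def d(1) field_simps)
    also have "cnj a * a = (\<Sum>x\<in>S. \<Sum>y\<in>S. cnj (v x) * (A x z * A z y) * v y)"
      unfolding ca[symmetric] unfolding a_def sum_product by (simp add: mult.assoc)
    also have "(\<Sum>x\<in>S. \<Sum>y\<in>S. cnj (v x) * A x y * v y) - \<dots> / of_real d =
        (\<Sum>x\<in>S. \<Sum>y\<in>S. cnj (v x) * B x y * v y)"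
      by (simp add: B_def right_diff_distrib left_diff_distrib sum_subtractf sum_divide_distrib)
    finally show "0 \<le> Re (\<Sum>x\<in>S. \<Sum>y\<in>S. cnj (v x) * B x y * v y)"
      using psd_on_nonneg[OF insert.prems, of v'] by simp
  qed
  then obtain V where V: "\<And>x y. x \<in> S \<Longrightarrow> y \<in> S \<Longrightarrow> B x y = ip (card S) (V x) (V y)"
    using insert.IH by blast
  \<comment> \<open>The factor of \<open>B\<close> fills the first \<open>card S\<close>
    coordinates; the new last coordinate restores the subtracted rank-one term and the pivot
    row.\<close>
  define V' where "V' x l = (if l < card S then if x = z then 0 else V x l
    else if x = z then of_real (sqrt d) else A z x / of_real (sqrt d))" for x l
  have ip': "ip (card (insert z S)) (V' x) (V' y) =
    ip (card S) (V' x) (V' y) + cnj (V' x (card S)) * V' y (card S)" for x y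
    using insert.hyps by (simp add: ip_def)
  have sq: "complex_of_real (sqrt d) * of_real (sqrt d) = of_real d"
    using d(2) by (simp flip: of_real_mult)
  have VS: "ip (card S) (V' x) (V' y) = B x y" if "x \<in> S" "y \<in> S" for x y
    unfolding V[OF that] using that insert.hyps by (intro ip_cong) (auto simp: V'_def)
  have Vz: "ip (card S) (V' z) u = 0" "ip (card S) u (V' z) = 0" for u
    by (simp_all add: ip_def V'_def)
  have "A x y = ip (card (insert z S)) (V' x) (V' y)" if xy: "x \<in> insert z S" "y \<in> insert z S" for x y
  proof -
    consider "x = z" "y = z" | "x = z" "y \<in> S" "y \<noteq> z" | "x \<in> S" "y = z" "x \<noteq> z"
      | "x \<in> S" "y \<in> S" "x \<noteq> z" "y \<noteq> z"
      using xy insert.hyps by blast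
    then show ?thesis
    proof cases
      case 1
      then show ?thesis by (simp add: ip' Vz) (simp add: V'_def sq d)
    next
      case 2
      then show ?thesis
        using row0[of y] d(2) by (cases "d = 0") (simp_all add: ip' Vz, simp_all add: V'_def)
    next
      case 3
      then show ?thesis
        using row0[of x] d(2) sym[of x z]
        by (cases "d = 0") (simp_all add: ip' Vz, simp_all add: V'_def)
    next
      case 4
      then have "cnj (A z x) = A x z" using sym[of x z] by simp
      then show ?thesis
        using 4 by (simp add: ip' VS) (simp add: V'_def sq B_def)
    qed
  qed
  then show ?case by blast
qed

section \<open>Kernels of a weighted decision tree\<close>

lemma weighting_scheme_child:
  assumes "weighting_scheme (Node i cs) w" "map_of cs a = Some c"
  shows "weighting_scheme c (\<lambda>p. w (a # p))"
proof -
  have s: "subtree (Node i cs) (a # p) = subtree c p" for p using assms(2) by simp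
  have 1: "0 \<le> w p" if "subtree (Node i cs) p \<noteq> None" for p
    using assms(1) that unfolding weighting_scheme_def by blast
  have 2: "w p = 0" if "subtree (Node i cs) p = Some (Leaf out)" for p out
    using assms(1) that unfolding weighting_scheme_def by blast
  have 3: "\<exists>X Y. psd (length cs') X \<and> psd (length cs') Y \<and>
           (\<forall>j1<length cs'. \<forall>j2<length cs'. j1 \<noteq> j2 \<longrightarrow> X j1 j2 - Y j1 j2 = 1) \<and>
           (\<forall>j<length cs'. w p - w (p @ [fst (cs' ! j)]) \<ge> Re (X j j + Y j j))"
    if "subtree (Node i cs) p = Some (Node i' cs')" for p i' cs'
    using assms(1) that unfolding weighting_scheme_def by blast
  show ?thesis
    unfolding weighting_scheme_def
    using 1[of "a # _"] 2[of "a # _"] 3[of "a # _"] unfolding s by simp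
qed

text \<open>The kernels \<open>A i\<close> and \<open>B i\<close> collect the matrices $X$ and $Y$ of all nodes that query index
  \<open>i\<close>, restricted to pairs of inputs that both reach the node; \<open>leaf\<close> encodes the leaf reached.\<close>

lemma tree_kernels:
  assumes "wf_tree n k T" "weighting_scheme T w" "finite D" "\<forall>x\<in>D. eval_tree T x \<noteq> None"
  shows "\<exists>(A :: nat \<Rightarrow> nat list \<Rightarrow> nat list \<Rightarrow> complex) B (leaf :: nat list \<Rightarrow> nat).
    (\<forall>i. psd_on D (A i)) \<and> (\<forall>i. psd_on D (B i)) \<and>
    (\<forall>x\<in>D. \<forall>y\<in>D. leaf x = leaf y \<longrightarrow> eval_tree T x = eval_tree T y) \<and>
    (\<forall>x\<in>D. \<forall>y\<in>D. (\<Sum>i<n. if x ! i = y ! i then 0 else A i x y - B i x y)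
        = (if leaf x = leaf y then 0 else 1)) \<and>
    (\<forall>x\<in>D. (\<Sum>i<n. Re (A i x x + B i x x)) \<le> w [])"
  using assms
proof (induction T arbitrary: w D)
  case (Leaf out)
  then have "0 \<le> w []"
    by (auto simp: weighting_scheme_def)
  then show ?case
    by (intro exI[of _ "\<lambda>_ _ _. 0"] exI[of _ "\<lambda>_. 0"]) (auto simp: psd_on_zero intro: sum.neutral)
next
  case (Node i cs)
  note ws = Node.prems(2)
  have "subtree (Node i cs) [] = Some (Node i cs)" by simp
  then obtain X Y where XY: "psd (length cs) X" "psd (length cs) Y"
    and XY1: "\<And>j1 j2. j1 < length cs \<Longrightarrow> j2 < length cs \<Longrightarrow> j1 \<noteq> j2 \<Longrightarrow> X j1 j2 - Y j1 j2 = 1"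
    and XYw: "\<And>j. j < length cs \<Longrightarrow> w [] - w ([] @ [fst (cs ! j)]) \<ge> Re (X j j + Y j j)"
    using ws unfolding weighting_scheme_def by metis
  have i: "i < n" using Node.prems(1) by simp
  have child: "\<exists>c. map_of cs (x ! i) = Some c \<and> eval_tree (Node i cs) x = eval_tree c x"
    if "x \<in> D" for x
    using Node.prems(4) that by (auto split: option.splits)
  have "\<exists>j. j < length cs \<and> fst (cs ! j) = x ! i" if x: "x \<in> D" for x
  proof -
    from child[OF x] obtain c where "(x ! i, c) \<in> set cs" by (blast dest: map_of_SomeD)
    then show ?thesis by (metis fst_conv in_set_conv_nth)
  qed
  then have "\<exists>j. j < length cs \<and> fst (cs ! j) = a" if "a \<in> (\<lambda>x. x ! i) ` D" for a
    using that by blast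
  \<comment> \<open>\<open>X\<close> and \<open>Y\<close> are indexed by positions in
    \<open>cs\<close>; \<open>J\<close> turns a symbol into the position of its child.\<close>
  then obtain J where J: "\<And>a. a \<in> (\<lambda>x. x ! i) ` D \<Longrightarrow> J a < length cs \<and> fst (cs ! J a) = a"
    by metis
  define D' where "D' a = {x \<in> D. x ! i = a}" for a
  \<comment> \<open>The claim for branch \<open>a\<close>, named so that kernels for all branches
    can be chosen at once.\<close>
  define P where "P a A B leaf \<longleftrightarrow> (\<forall>i. psd_on (D' a) (A i)) \<and> (\<forall>i. psd_on (D' a) (B i)) \<and>
    (\<forall>x\<in>D' a. \<forall>y\<in>D' a. leaf x = leaf y \<longrightarrow> eval_tree (Node i cs) x = eval_tree (Node i cs) y) \<and>
    (\<forall>x\<in>D' a. \<forall>y\<in>D' a. (\<Sum>i<n. if x ! i = y ! i then 0 else A i x y - B i x y)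
        = (if leaf x = leaf y then 0 else 1)) \<and>
    (\<forall>x\<in>D' a. (\<Sum>i<n. Re (A i x x + B i x x)) \<le> w [a])"
    for a and A B :: "nat \<Rightarrow> nat list \<Rightarrow> nat list \<Rightarrow> complex" and leaf :: "nat list \<Rightarrow> nat"
  have "\<exists>A B leaf. P a A B leaf" for a
  proof (cases "D' a = {}")
    \<comment> \<open>No input takes this branch, and \<open>a\<close> need not even label an edge:
      all conditions hold trivially.\<close>
    case True
    then show ?thesis
      unfolding P_def by (intro exI[of _ "\<lambda>_ _ _. 0"] exI[of _ "\<lambda>_. 0"]) (simp add: psd_on_zero)
  next
    case False
    then obtain x0 where "x0 \<in> D" "x0 ! i = a" by (auto simp: D'_def)
    then obtain c where c: "map_of cs a = Some c" using child by blast
    then have mem: "(a, c) \<in> set cs" by (rule map_of_SomeD)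
    have ev: "eval_tree (Node i cs) x = eval_tree c x" if "x \<in> D' a" for x
      using that c by (simp add: D'_def)
    have "\<exists>(A :: nat \<Rightarrow> nat list \<Rightarrow> nat list \<Rightarrow> complex) B (leaf :: nat list \<Rightarrow> nat).
      (\<forall>i. psd_on (D' a) (A i)) \<and> (\<forall>i. psd_on (D' a) (B i)) \<and>
      (\<forall>x\<in>D' a. \<forall>y\<in>D' a. leaf x = leaf y \<longrightarrow> eval_tree c x = eval_tree c y) \<and>
      (\<forall>x\<in>D' a. \<forall>y\<in>D' a. (\<Sum>i<n. if x ! i = y ! i then 0 else A i x y - B i x y)
          = (if leaf x = leaf y then 0 else 1)) \<and>
      (\<forall>x\<in>D' a. (\<Sum>i<n. Re (A i x x + B i x x)) \<le> w [a])"
    proof (rule Node.IH)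
      show "(a, c) \<in> set cs" "c \<in> Basic_BNFs.snds (a, c)" using mem by auto
      show "wf_tree n k c" using Node.prems(1) mem by auto
      show "weighting_scheme c (\<lambda>p. w (a # p))" using weighting_scheme_child[OF ws c] .
      show "finite (D' a)" using Node.prems(3) by (simp add: D'_def)
      show "\<forall>x\<in>D' a. eval_tree c x \<noteq> None"
        using Node.prems(4) ev by (metis (mono_tags, lifting) D'_def mem_Collect_eq)
    qed
    then show ?thesis unfolding P_def using ev by simp
  qed
  then obtain A B leaf where P: "\<And>a. P a (A a) (B a) (leaf a)"
    by metis
  have psdA: "\<And>a i. psd_on (D' a) (A a i)" and psdB: "\<And>a i. psd_on (D' a) (B a i)"
    and leaf: "\<And>a x y. x \<in> D' a \<Longrightarrow> y \<in> D' a \<Longrightarrow> leaf a x = leaf a y \<Longrightarrow>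
      eval_tree (Node i cs) x = eval_tree (Node i cs) y"
    and AB: "\<And>a x y. x \<in> D' a \<Longrightarrow> y \<in> D' a \<Longrightarrow>
      (\<Sum>i<n. if x ! i = y ! i then 0 else A a i x y - B a i x y)
        = (if leaf a x = leaf a y then 0 else 1)"
    and ABw: "\<And>a x. x \<in> D' a \<Longrightarrow> (\<Sum>i<n. Re (A a i x x + B a i x x)) \<le> w [a]"
    using P unfolding P_def by blast+
  \<comment> \<open>The matrix of the root enters at index \<open>i\<close> only, pulled back to
    inputs; the kernels of the branches form a block-diagonal sum, so pairs separated at the root
    get nothing from below.\<close>
  define lift where "lift X A = (\<lambda>i' x y. (if i' = i then X (J (x ! i)) (J (y ! i)) else 0) +
    (if x ! i = y ! i then A (x ! i) i' x y else 0))"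
    for X :: "nat \<Rightarrow> nat \<Rightarrow> complex" and A :: "nat \<Rightarrow> nat \<Rightarrow> nat list \<Rightarrow> nat list \<Rightarrow> complex"
  \<comment> \<open>Pairing with the symbol keeps leaves below different children apart, even if
    they carry the same output.\<close>
  define leaf' where "leaf' x = prod_encode (x ! i, leaf (x ! i) x)" for x
  have psd_lift: "psd_on D (lift X A i')"
    if "psd (length cs) X" "\<And>a i. psd_on (D' a) (A a i)" for X A i'
    unfolding lift_def
  proof (rule psd_on_add)
    have "psd_on D (\<lambda>x y. X (J (x ! i)) (J (y ! i)))"
      using that(1) Node.prems(3) J unfolding psd_on_lessThan
      by (intro psd_on_pullback[where h = "\<lambda>x. J (x ! i)"]) auto
    then show "psd_on D (\<lambda>x y. if i' = i then X (J (x ! i)) (J (y ! i)) else 0)"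
      by (cases "i' = i") (simp_all add: psd_on_zero)
    show "psd_on D (\<lambda>x y. if x ! i = y ! i then A (x ! i) i' x y else 0)"
      using that(2) unfolding D'_def
      by (intro psd_on_block_diagonal[where h = "\<lambda>x. x ! i" and B = "\<lambda>a. A a i'"] Node.prems(3))
  qed
  have 1: "eval_tree (Node i cs) x = eval_tree (Node i cs) y"
    if "x \<in> D" "y \<in> D" "leaf' x = leaf' y" for x y
    using that leaf[of x "x ! i" y] by (auto simp: leaf'_def D'_def)
  have 2: "(\<Sum>i'<n. if x ! i' = y ! i' then 0 else lift X A i' x y - lift Y B i' x y)
        = (if leaf' x = leaf' y then 0 else 1)" if xy: "x \<in> D" "y \<in> D" for x y
  proof (cases "x ! i = y ! i")
    \<comment> \<open>The term of the root sits at index \<open>i\<close>, where the inputs agree,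
      and is masked; the sum is that of the common branch.\<close>
    case True
    have "(\<Sum>i'<n. if x ! i' = y ! i' then 0 else lift X A i' x y - lift Y B i' x y) =
      (\<Sum>i'<n. if x ! i' = y ! i' then 0 else A (x ! i) i' x y - B (x ! i) i' x y)"
      using True by (intro sum.cong) (auto simp: lift_def)
    also have "\<dots> = (if leaf (x ! i) x = leaf (x ! i) y then 0 else 1)"
      using xy True by (intro AB) (auto simp: D'_def)
    finally show ?thesis using True by (simp add: leaf'_def)
  next
    \<comment> \<open>Here the paths diverge: the branch kernels vanish, and the root contributes an
      off-diagonal entry of X - Y, which is 1.\<close>
    case False
    have "J (x ! i) \<noteq> J (y ! i)" using J xy False by (metis imageI)
    moreover have "J (x ! i) < length cs" "J (y ! i) < length cs" using J xy by auto
    ultimately have "X (J (x ! i)) (J (y ! i)) - Y (J (x ! i)) (J (y ! i)) = 1" by (intro XY1)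
    then have "(\<Sum>i'<n. if x ! i' = y ! i' then 0 else lift X A i' x y - lift Y B i' x y) =
      (\<Sum>i'<n. if i' = i then 1 else 0)"
      using False by (intro sum.cong) (auto simp: lift_def)
    then show ?thesis using i False by (simp add: leaf'_def)
  qed
  have 3: "(\<Sum>i'<n. Re (lift X A i' x x + lift Y B i' x x)) \<le> w []" if x: "x \<in> D" for x
  proof -
    let ?j = "J (x ! i)"
    have j: "?j < length cs" "fst (cs ! ?j) = x ! i" using J x by auto
    have "(\<Sum>i'<n. Re (lift X A i' x x + lift Y B i' x x)) =
      (\<Sum>i'<n. (if i' = i then Re (X ?j ?j + Y ?j ?j) else 0) + Re (A (x ! i) i' x x + B (x ! i) i' x x))"
      by (intro sum.cong) (auto simp: lift_def)
    also have "\<dots> = Re (X ?j ?j + Y ?j ?j) + (\<Sum>i'<n. Re (A (x ! i) i' x x + B (x ! i) i' x x))"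
      unfolding sum.distrib using i by simp
    also have "(\<Sum>i'<n. Re (A (x ! i) i' x x + B (x ! i) i' x x)) \<le> w [x ! i]"
      using x by (intro ABw) (simp add: D'_def)
    \<comment> \<open>The inequality at the root and the bound for the branch telescope to
      \<open>w []\<close>.\<close>
    also have "Re (X ?j ?j + Y ?j ?j) \<le> w [] - w [x ! i]" using XYw[OF j(1)] j(2) by simp
    finally show ?thesis by simp
  qed
  show ?case
    by (intro exI[of _ "lift X A"] exI[of _ "lift Y B"] exI[of _ leaf'] conjI allI ballI impI
        psd_lift[OF XY(1) psdA] psd_lift[OF XY(2) psdB] 1 2 3)
qed

section \<open>Queries\<close>

lemma sum_lessThan_add:
  fixes F :: "nat \<Rightarrow> 'a::comm_monoid_add"
  shows "(\<Sum>c<a + b. F c) = (\<Sum>c<a. F c) + (\<Sum>c<b. F (a + c))"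
  by (induction b) (simp_all add: add.assoc)

lemma sum_lessThan_mult:
  fixes F :: "nat \<Rightarrow> 'a::comm_monoid_add"
  shows "(\<Sum>c<a * m. F c) = (\<Sum>q<a. \<Sum>w<m. F (q * m + w))"
  by (induction a) (simp_all add: sum_lessThan_add add.commute[of m])

definition idx :: "nat \<Rightarrow> nat \<Rightarrow> nat \<Rightarrow> nat \<Rightarrow> nat \<Rightarrow> nat" where
  "idx k m i b w = (i * k + b) * m + w"

definition vec :: "nat \<Rightarrow> nat \<Rightarrow> (nat \<Rightarrow> nat \<Rightarrow> nat \<Rightarrow> complex) \<Rightarrow> nat \<Rightarrow> complex" where
  "vec k m \<psi> c = \<psi> (c div (k * m)) (c div m mod k) (c mod m)"

lemma sum_idx: "(\<Sum>c<n * k * m. F c) = (\<Sum>i<n. \<Sum>b<k. \<Sum>w<m. F (idx k m i b w))"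
  by (simp add: sum_lessThan_mult idx_def)

lemma idx_decode:
  assumes "b < k" "w < m"
  shows "idx k m i b w div (k * m) = i" "idx k m i b w div m mod k = b" "idx k m i b w mod m = w"
proof -
  have "idx k m i b w div m = i * k + b" using assms by (simp add: idx_def)
  then show "idx k m i b w div m mod k = b" "idx k m i b w div (k * m) = i"
    using assms by (simp_all add: mult.commute[of k] div_mult2_eq)
qed (use assms in \<open>simp add: idx_def\<close>)

lemma vec_idx: "b < k \<Longrightarrow> w < m \<Longrightarrow> vec k m \<psi> (idx k m i b w) = \<psi> i b w"
  by (simp add: vec_def idx_decode)

lemma idx_less:
  assumes "i < n" "b < k" "w < m"
  shows "idx k m i b w < n * k * m"
proof -
  have lt: "q * l + r < p * l" if "q < p" "r < l" for p q r l :: nat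
  proof -
    have "q * l + r < Suc q * l" using that by simp
    also have "\<dots> \<le> p * l" using that by (intro mult_le_mono1) simp
    finally show ?thesis .
  qed
  show ?thesis unfolding idx_def using assms by (intro lt)
qed

lemma idx_exhaust:
  assumes "c < n * k * m"
  obtains i b w where "i < n" "b < k" "w < m" "c = idx k m i b w"
proof
  have pos: "k > 0" "m > 0" using assms by (auto intro: gr0I)
  show "c div (k * m) < n" using assms pos by (simp add: div_less_iff_less_mult mult.assoc)
  show "c div m mod k < k" "c mod m < m" using pos by auto
  show "c = idx k m (c div (k * m)) (c div m mod k) (c mod m)"
    unfolding idx_def by (simp add: mult.commute[of k] div_mult2_eq)
qed

lemma ip_vec:
  "ip (n * k * m) (vec k m \<psi>) (vec k m \<chi>) = (\<Sum>i<n. \<Sum>b<k. \<Sum>w<m. cnj (\<psi> i b w) * \<chi> i b w)"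
  unfolding ip_def sum_idx by (intro sum.cong) (simp_all add: vec_idx)

lemma mod_shift_iff:
  fixes b b' a k :: nat
  assumes "b < k" "b' < k" "a < k"
  shows "b = (b' + a) mod k \<longleftrightarrow> b' = (b + (k - a)) mod k"
  using assms by (auto simp: mod_if)

text \<open>The row of |i,b,w> has its only 1 in the column of |i, b - x_i, w>. The difference is
  written b + (k - x_i) because subtraction on naturals truncates.\<close>

lemma query_op_vec:
  assumes "\<And>i. i < n \<Longrightarrow> x ! i < k" "c < n * k * m"
  shows "mat_vec (n * k * m) (query_op n k m x) (vec k m \<psi>) c =
    vec k m (\<lambda>i b w. \<psi> i ((b + (k - x ! i)) mod k) w) c"
proof -
  obtain i b w where c: "i < n" "b < k" "w < m" "c = idx k m i b w"
    using idx_exhaust[OF assms(2)] by blast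
  define b0 where "b0 = (b + (k - x ! i)) mod k"
  have b0: "b0 < k" using c by (simp add: b0_def)
  have iff: "c = query_perm k m x c' \<longleftrightarrow> c' = idx k m i b0 w" if c': "c' < n * k * m" for c'
  proof -
    obtain i' b' w' where d: "i' < n" "b' < k" "w' < m" "c' = idx k m i' b' w'"
      using idx_exhaust[OF c'] by blast
    have q: "query_perm k m x c' = idx k m i' ((b' + x ! i') mod k) w'"
      unfolding query_perm_def Let_def d(4) using d by (simp add: idx_decode) (simp add: idx_def)
    have inj: "idx k m i1 b1 w1 = idx k m i2 b2 w2 \<longleftrightarrow> i1 = i2 \<and> b1 = b2 \<and> w1 = w2"
      if "b1 < k" "b2 < k" "w1 < m" "w2 < m" for i1 i2 b1 b2 w1 w2
      using that by (metis idx_decode)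
    have "(b' + x ! i') mod k < k" using d by simp
    then show ?thesis
      unfolding q unfolding c(4) d(4) using c d b0 mod_shift_iff[of b k b' "x ! i"] assms(1)[of i]
      by (auto simp: inj b0_def)
  qed
  have "mat_vec (n * k * m) (query_op n k m x) (vec k m \<psi>) c =
    (\<Sum>c'<n * k * m. if c' = idx k m i b0 w then vec k m \<psi> c' else 0)"
    using assms(2)
    by (simp add: mat_vec_def query_op_def iff if_distrib[where f="\<lambda>a. a * _"] cong: if_cong)
  also have "\<dots> = vec k m \<psi> (idx k m i b0 w)"
    using idx_less[OF c(1) b0 c(3)] by simp
  finally show ?thesis using c b0 by (simp add: vec_idx b0_def)
qed

lemma sum_mod_shift:
  fixes F :: "nat \<Rightarrow> 'a::comm_monoid_add"
  assumes "a < k"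
  shows "(\<Sum>b<k. F ((b + (k - a)) mod k)) = (\<Sum>b<k. F b)"
proof (rule sum.reindex_bij_witness[where j = "\<lambda>b. (b + (k - a)) mod k" and i = "\<lambda>b. (b + a) mod k"])
  show "((b + (k - a)) mod k + a) mod k = b" if "b \<in> {..<k}" for b
    using mod_shift_iff[of b k "(b + (k - a)) mod k" a] that assms by auto
  show "((b + a) mod k + (k - a)) mod k = b" if "b \<in> {..<k}" for b
    using mod_shift_iff[of "(b + a) mod k" k b a] that assms by auto
qed (use assms in auto)

lemma query_op_isometry:
  fixes n k m :: nat
  assumes "\<And>i. i < n \<Longrightarrow> x ! i < k"
  defines "N \<equiv> n * k * m"
  shows "ip N (mat_vec N (query_op n k m x) u) (mat_vec N (query_op n k m x) v) = ip N u v"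
proof -
  define f where "f u = (\<lambda>i b w. u (idx k m i b w))" for u :: "nat \<Rightarrow> complex"
  have f: "u c = vec k m (f u) c" if "c < N" for u c
    using that unfolding N_def by (elim idx_exhaust) (simp add: vec_idx f_def)
  have mv: "mat_vec N (query_op n k m x) u c =
    vec k m (\<lambda>i b w. f u i ((b + (k - x ! i)) mod k) w) c" if "c < N" for u c
  proof -
    have "mat_vec N (query_op n k m x) u = mat_vec N (query_op n k m x) (vec k m (f u))"
      by (rule mat_vec_cong) (rule f)
    then show ?thesis using query_op_vec[OF assms(1), of n] that by (simp add: N_def)
  qed
  have "ip N (mat_vec N (query_op n k m x) u) (mat_vec N (query_op n k m x) v) =
    ip N (vec k m (\<lambda>i b w. f u i ((b + (k - x ! i)) mod k) w))
      (vec k m (\<lambda>i b w. f v i ((b + (k - x ! i)) mod k) w))"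
    by (intro ip_cong mv)
  also have "\<dots> = ip N (vec k m (f u)) (vec k m (f v))"
    unfolding N_def ip_vec
    using assms(1) by (intro sum.cong refl sum_mod_shift) auto
  also have "\<dots> = ip N u v"
    by (rule ip_cong) (simp_all flip: f)
  finally show ?thesis .
qed

text \<open>\<open>run\<close> recurses from the front, while the error analysis adds one query and
  one unitary at the end.\<close>

lemma run_snoc: "Us \<noteq> [] \<Longrightarrow> run N Ox (Us @ [U]) v = mat_vec N U (mat_vec N Ox (run N Ox Us v))"
  by (induction N Ox Us v rule: run.induct) (auto simp: neq_Nil_conv)

section \<open>The algorithm\<close>

text \<open>The workspace is $C^d \oplus C^d \oplus C \oplus C^L$.
  The two copies of $C^d$ carry the catalyst, with the symbol register at \<open>pa i\<close> and \<open>pb i\<close>; on the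
  rest (the starting state and the leaf states) the symbol register is in the uniform
  superposition, which every query leaves invariant.\<close>

definition alg_state :: "nat \<Rightarrow> (nat \<Rightarrow> nat \<Rightarrow> complex) \<Rightarrow> (nat \<Rightarrow> nat \<Rightarrow> complex) \<Rightarrow>
    (nat \<Rightarrow> nat) \<Rightarrow> (nat \<Rightarrow> nat) \<Rightarrow> complex \<Rightarrow> complex \<Rightarrow> nat \<Rightarrow> nat \<Rightarrow> nat \<Rightarrow> nat \<Rightarrow> complex" where
  "alg_state d va vb pa pb s t h i b w =
    (if w < d then if b = pa i then va i w else 0
     else if w < d + d then if b = pb i then vb i (w - d) else 0
     else if i \<noteq> 0 then 0
     else if w = d + d then s
     else if w = d + d + 1 + h then t else 0)"

lemma ip_alg_state:
  fixes n k d L :: nat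
  assumes "n \<ge> 1" "h < L" "h' < L"
    and "\<And>i. i < n \<Longrightarrow> pa i < k" "\<And>i. i < n \<Longrightarrow> pb i < k"
  defines "m \<equiv> d + (d + (1 + L))"
  shows "ip (n * k * m) (vec k m (alg_state d va vb pa pb s t h))
      (vec k m (alg_state d va' vb' pa' pb' s' t' h')) =
    (\<Sum>i<n. (if pa i = pa' i then ip d (va i) (va' i) else 0) +
      (if pb i = pb' i then ip d (vb i) (vb' i) else 0)) +
    of_nat k * (cnj s * s' + (if h = h' then cnj t * t' else 0))"
proof -
  let ?f = "alg_state d va vb pa pb s t h" and ?g = "alg_state d va' vb' pa' pb' s' t' h'"
  have w: "(\<Sum>w<m. cnj (?f i b w) * ?g i b w) =
    (if b = pa i then if pa i = pa' i then ip d (va i) (va' i) else 0 else 0) +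
    (if b = pb i then if pb i = pb' i then ip d (vb i) (vb' i) else 0 else 0) +
    (if i = 0 then cnj s * s' + (if h = h' then cnj t * t' else 0) else 0)" for i b
  proof -
    have 1: "(\<Sum>w<d. cnj (?f i b w) * ?g i b w) =
      (if b = pa i then if pa i = pa' i then ip d (va i) (va' i) else 0 else 0)"
      by (auto simp: alg_state_def ip_def intro!: sum.neutral)
    have 2: "(\<Sum>w<d. cnj (?f i b (d + w)) * ?g i b (d + w)) =
      (if b = pb i then if pb i = pb' i then ip d (vb i) (vb' i) else 0 else 0)"
      by (auto simp: alg_state_def ip_def intro!: sum.neutral)
    have 3: "(\<Sum>w<L. cnj (?f i b (d + (d + (1 + w)))) * ?g i b (d + (d + (1 + w)))) =
      (\<Sum>w<L. if w = h then if i = 0 \<and> h = h' then cnj t * t' else 0 else 0)"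
      by (rule sum.cong) (auto simp: alg_state_def)
    show ?thesis
      unfolding m_def sum_lessThan_add 1 2 3 using assms(2) by (auto simp: alg_state_def)
  qed
  have "(\<Sum>b<k. \<Sum>w<m. cnj (?f i b w) * ?g i b w) =
    (if pa i = pa' i then ip d (va i) (va' i) else 0) +
    (if pb i = pb' i then ip d (vb i) (vb' i) else 0) +
    (if i = 0 then of_nat k * (cnj s * s' + (if h = h' then cnj t * t' else 0)) else 0)"
    if "i < n" for i
    unfolding w sum.distrib using assms(4,5)[OF that] by simp
  then show ?thesis
    unfolding ip_vec using assms(1) by (simp add: sum.distrib)
qed

text \<open>Weighted arithmetic-geometric mean inequality. The weights fit the success bound: an
  error of squared norm 1/30 leaves 5/6 - 5/30 = 2/3.\<close>

lemma norm_add_sq_ge: "(cmod (a + e))\<^sup>2 \<ge> 5 / 6 * (cmod a)\<^sup>2 - 5 * (cmod e)\<^sup>2"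
proof -
  have "cmod a = cmod ((a + e) - e)" by simp
  also have "\<dots> \<le> cmod (a + e) + cmod e" by (rule norm_triangle_ineq4)
  finally have "(cmod a)\<^sup>2 \<le> (cmod (a + e) + cmod e)\<^sup>2" by (intro power_mono) auto
  moreover have "0 \<le> (cmod (a + e) - 5 * cmod e)\<^sup>2" by simp
  ultimately show ?thesis by (simp add: power2_eq_square algebra_simps)
qed

lemma finite_inputs: "finite (inputs n k)"
proof -
  have "inputs n k = {xs. set xs \<subseteq> {..<k} \<and> length xs = n}" by (auto simp: inputs_def)
  then show ?thesis by (simp add: finite_lists_length_eq)
qed

text \<open>Serves root weights below 1, where a multiple of the weight may leave no room for a
  single query.\<close>

lemma quantum_computes_constant:
  assumes "1 \<le> n" "1 \<le> k" "\<And>x y. x \<in> D \<Longrightarrow> y \<in> D \<Longrightarrow> f x = f y"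
  shows "quantum_computes n k D f 0"
proof -
  obtain o' where o': "\<And>x. x \<in> D \<Longrightarrow> f x = o'"
    using assms(3) by metis
  have N: "0 < n * k * 1" using assms by simp
  have "(\<Sum>j<n * k * 1. (cmod (mat_vec (n * k * 1) identity init_state j))\<^sup>2) =
    (\<Sum>j<n * k * 1. if j = 0 then 1 else 0)"
    by (rule sum.cong) (auto simp: mat_vec_identity init_state_def)
  then have "success_prob n k 1 [identity] (\<lambda>_. o') x (f x) \<ge> 2 / 3" if "x \<in> D" for x
    using N o'[OF that] by (simp add: success_prob_def flip: lessThan_def)
  then show ?thesis
    unfolding quantum_computes_def
    by (intro exI[of _ 1] exI[of _ "[identity]"] exI[of _ "\<lambda>_. o'"]) (simp add: unitary_identity)
qed

lemma quantum_computes_kernels: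
  fixes A B :: "nat \<Rightarrow> nat list \<Rightarrow> nat list \<Rightarrow> complex" and leaf :: "nat list \<Rightarrow> nat"
  assumes nk: "1 \<le> n" "1 \<le> k" and D: "D \<subseteq> inputs n k"
    and A: "\<And>i. psd_on D (A i)" and B: "\<And>i. psd_on D (B i)"
    and leaf: "\<And>x y. x \<in> D \<Longrightarrow> y \<in> D \<Longrightarrow> leaf x = leaf y \<Longrightarrow> f x = f y"
    and AB: "\<And>x y. x \<in> D \<Longrightarrow> y \<in> D \<Longrightarrow>
      (\<Sum>i<n. if x ! i = y ! i then 0 else A i x y - B i x y) = (if leaf x = leaf y then 0 else 1)"
    and W: "\<And>x. x \<in> D \<Longrightarrow> (\<Sum>i<n. Re (A i x x + B i x x)) \<le> W"
    and K: "1 \<le> K" "30 * W \<le> real K"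
  shows "quantum_computes n k D f K"
proof -
  have finD: "finite D" using D finite_inputs by (rule finite_subset)
  have xk: "x ! i < k" if "x \<in> D" "i < n" for x i
    using D that by (auto simp: inputs_def subset_iff)
  define d where "d = card D"
  obtain Va where Va: "\<And>i x y. x \<in> D \<Longrightarrow> y \<in> D \<Longrightarrow> A i x y = ip d (Va i x) (Va i y)"
    using psd_on_gram[OF finD A] unfolding d_def by metis
  obtain Vb where Vb: "\<And>i x y. x \<in> D \<Longrightarrow> y \<in> D \<Longrightarrow> B i x y = ip d (Vb i x) (Vb i y)"
    using psd_on_gram[OF finD B] unfolding d_def by metis
  \<comment> \<open>\<open>L\<close> exceeds every leaf code; inserting 0 keeps \<open>Max\<close>
    meaningful for empty \<open>D\<close>.\<close>
  define L where "L = Suc (Max (insert 0 (leaf ` D)))"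
  have L: "leaf x < L" if "x \<in> D" for x
    using that finD by (simp add: L_def less_Suc_eq_le)
  define m where "m = d + (d + (1 + L))"
  define N where "N = n * k * m"
  define r where "r = complex_of_real (1 / sqrt K)"
  have r: "cnj r * r = 1 / of_nat K"
    using K by (simp add: r_def flip: of_real_mult)
  \<comment> \<open>The factor \<open>k\<close> in the denominator offsets the spread over all
    symbols: the starting part and the leaf part get squared norms (K - j)/K and j/K.\<close>
  define s where "s j = complex_of_real (sqrt (real (K - j) / (K * k)))" for j
  define t where "t j = complex_of_real (sqrt (real j / (K * k)))" for j
  define va where "va x i = (\<lambda>w. Va i x w * r)" for x i
  define vb where "vb x i = (\<lambda>w. Vb i x w * r)" for x i
  have ip_va: "ip d (va x i) (va y i) = A i x y / of_nat K" if "x \<in> D" "y \<in> D" for x y i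
    using r Va[OF that, of i] by (simp add: va_def ip_scale_left ip_scale_right flip: mult.assoc)
  have ip_vb: "ip d (vb x i) (vb y i) = B i x y / of_nat K" if "x \<in> D" "y \<in> D" for x y i
    using r Vb[OF that, of i] by (simp add: vb_def ip_scale_left ip_scale_right flip: mult.assoc)
  \<comment> \<open>This is -x_i in the cyclic group; the outer \<open>mod\<close> sends
    \<open>k\<close> to 0.\<close>
  define neg where "neg x i = (k - x ! i) mod k" for x i
  have neg_eq: "neg x i = neg y i \<longleftrightarrow> x ! i = y ! i" if "x \<in> D" "y \<in> D" "i < n" for x y i
    using xk[OF that(1,3)] xk[OF that(2,3)] by (auto simp: neg_def mod_if)
  have neg_less: "neg x i < k" for x i using nk by (simp add: neg_def)
  \<comment> \<open>A query moves the A-part from symbol 0 to x_i and the B-part from -x_i to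
    0.\<close>
  define pre where "pre j x = vec k m (alg_state d (va x) (vb x) (\<lambda>_. 0) (neg x) (s j) (t j) (leaf x))" for j x
  define post where "post j x = vec k m (alg_state d (va x) (vb x) ((!) x) (\<lambda>_. 0) (s j) (t j) (leaf x))" for j x
  have query: "mat_vec N (query_op n k m x) (pre j x) c = post j x c" if "x \<in> D" "c < N" for x j c
  proof -
    have "mat_vec N (query_op n k m x) (pre j x) c = vec k m (\<lambda>i b w. alg_state d (va x) (vb x) (\<lambda>_. 0)
      (neg x) (s j) (t j) (leaf x) i ((b + (k - x ! i)) mod k) w) c"
      unfolding pre_def N_def using that xk by (intro query_op_vec) (auto simp: N_def)
    also have "\<dots> = post j x c"
      using that(2) unfolding N_def
    proof (rule idx_exhaust)
      fix i b w assume c: "i < n" "b < k" "w < m" "c = idx k m i b w"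
      have x: "x ! i < k" using xk that(1) c by simp
      have 1: "(b + (k - x ! i)) mod k = 0 \<longleftrightarrow> b = x ! i"
        using x c(2) by (auto simp: mod_if)
      have 2: "(b + (k - x ! i)) mod k = neg x i \<longleftrightarrow> b = 0"
        using x c(2) by (auto simp: mod_if neg_def)
      show ?thesis
        unfolding c(4) post_def using c by (simp add: vec_idx alg_state_def 1 2)
    qed
    finally show ?thesis .
  qed
  have st: "of_nat k * (cnj (s j) * s j) = of_nat (K - j) / of_nat K"
    "of_nat k * (cnj (t j) * t j) = of_nat j / of_nat K" for j
    using nk K by (simp_all add: s_def t_def flip: of_real_mult) simp_all
  \<comment> \<open>From \<open>post j\<close> to \<open>pre (Suc j)\<close> the catalyst gains 1/K
    if the leaves differ, the leaf part gains 1/K if they agree, and the starting part loses 1/K in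
    either case.\<close>
  have gram: "ip N (post j x) (post j y) = ip N (pre (Suc j) x) (pre (Suc j) y)"
    if "x \<in> D" "y \<in> D" "j < K" for x y j
  proof -
    have eq: "of_nat k * (cnj (s j) * s j + (if leaf x = leaf y then cnj (t j) * t j else 0)) =
      (of_nat (K - j) + (if leaf x = leaf y then of_nat j else 0)) / of_nat K" for j
      using st[of j] by (simp add: distrib_left add_divide_distrib)
    have "ip N (post j x) (post j y) =
      (\<Sum>i<n. (if x ! i = y ! i then A i x y / of_nat K else 0) + B i x y / of_nat K) +
      (of_nat (K - j) + (if leaf x = leaf y then of_nat j else 0)) / of_nat K"
      unfolding post_def N_def m_def
      using that nk L xk by (subst ip_alg_state) (auto simp: ip_va ip_vb eq intro!: sum.cong)
    moreover have "ip N (pre (Suc j) x) (pre (Suc j) y) =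
      (\<Sum>i<n. A i x y / of_nat K + (if x ! i = y ! i then B i x y / of_nat K else 0)) +
      (of_nat (K - Suc j) + (if leaf x = leaf y then of_nat (Suc j) else 0)) / of_nat K"
      unfolding pre_def N_def m_def
      using that nk L neg_less
      by (subst ip_alg_state) (auto simp: ip_va ip_vb eq neg_eq simp del: of_nat_Suc intro!: sum.cong)
    moreover have "(\<Sum>i<n. A i x y / of_nat K + (if x ! i = y ! i then B i x y / of_nat K else 0)) -
      (\<Sum>i<n. (if x ! i = y ! i then A i x y / of_nat K else 0) + B i x y / of_nat K) =
      (\<Sum>i<n. if x ! i = y ! i then 0 else A i x y - B i x y) / of_nat K"
      unfolding sum_subtractf[symmetric] sum_divide_distrib
      by (intro sum.cong) (auto simp: diff_divide_distrib)
    moreover have "complex_of_nat (K - j) = of_nat (K - Suc j) + 1"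
      using that(3) by (simp add: of_nat_diff)
    ultimately show ?thesis
      using AB[OF that(1,2)] by (simp add: add_divide_distrib diff_divide_distrib algebra_simps split: if_splits)
  qed
  have "\<exists>U. unitary N U \<and> (\<forall>u v. ip N (mat_vec N U u) (mat_vec N U v) = ip N u v) \<and>
    (\<forall>x\<in>D. \<forall>c<N. mat_vec N U (post j x) c = pre (Suc j) x c)" if "j < K" for j
    using finD gram that by (intro unitary_extension) auto
  then obtain U where U: "\<And>j. j < K \<Longrightarrow> unitary N (U j)"
    "\<And>j u v. j < K \<Longrightarrow> ip N (mat_vec N (U j) u) (mat_vec N (U j) v) = ip N u v"
    "\<And>j x c. j < K \<Longrightarrow> x \<in> D \<Longrightarrow> c < N \<Longrightarrow> mat_vec N (U j) (post j x) c = pre (Suc j) x c"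
    by metis
  \<comment> \<open>The state with neither catalyst nor leaf part; leaf slot 0 is a placeholder with
    amplitude 0. It is a unit vector, so the extension lemma for a one-element family prepares it
    from \<open>init_state\<close>.\<close>
  define start where "start = vec k m (alg_state d (\<lambda>_ _. 0) (\<lambda>_ _. 0) (\<lambda>_. 0) (\<lambda>_. 0) (s 0) 0 0)"
  have m0: "0 < m" by (simp add: m_def)
  have N0: "0 < N" using nk m0 by (simp add: N_def)
  have "ip N init_state init_state = (\<Sum>c<N. if c = 0 then 1 else 0)"
    unfolding ip_def by (rule sum.cong) (auto simp: init_state_def)
  also have "\<dots> = 1" using N0 by simp
  also have "1 = ip N start start"
    unfolding start_def N_def m_def
    using nk K st(1)[of 0] by (subst ip_alg_state) (auto simp: L_def ip_def)
  finally have "\<exists>U. unitary N U \<and> (\<forall>u v. ip N (mat_vec N U u) (mat_vec N U v) = ip N u v) \<and>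
    (\<forall>x\<in>{()}. \<forall>c<N. mat_vec N U init_state c = start c)"
    by (intro unitary_extension) auto
  then obtain U0 where U0: "unitary N U0" "\<And>c. c < N \<Longrightarrow> mat_vec N U0 init_state c = start c"
    by blast
  define Us where "Us j = U0 # map U [0..<j]" for j
  \<comment> \<open>Any input with the measured leaf slot will do, since \<open>f\<close> is
    constant on inputs sharing a leaf. On other slots the value is arbitrary, which cannot lower the
    success probability.\<close>
  define g where "g c = f (SOME x. x \<in> D \<and> d + d + 1 + leaf x = c mod m)" for c
  have g: "g c = f x" if "x \<in> D" "c mod m = d + d + 1 + leaf x" for c x
  proof -
    have "\<exists>y. y \<in> D \<and> d + d + 1 + leaf y = c mod m" using that by metis
    from someI_ex[OF this] show ?thesis
      using that leaf unfolding g_def by (metis add_left_cancel)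
  qed
  have "success_prob n k m (Us K) g x (f x) \<ge> 2 / 3" if x: "x \<in> D" for x
  proof -
    define \<psi> where "\<psi> j = run N (query_op n k m x) (Us j) init_state" for j
    define err where "err j c = \<psi> j c - pre j x c" for j c
    have \<psi>0: "\<psi> 0 c = start c" if "c < N" for c
      using that U0 by (simp add: \<psi>_def Us_def)
    have \<psi>Suc: "\<psi> (Suc j) = mat_vec N (U j) (mat_vec N (query_op n k m x) (\<psi> j))" for j
      unfolding \<psi>_def Us_def using run_snoc[of "U0 # map U [0..<j]"] by simp
    have errSuc: "err (Suc j) c = mat_vec N (U j) (mat_vec N (query_op n k m x) (err j)) c"
      if "j < K" "c < N" for j c
    proof -
      have "mat_vec N (U j) (mat_vec N (query_op n k m x) (pre j x)) = mat_vec N (U j) (post j x)"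
        by (rule mat_vec_cong) (rule query[OF x])
      then have "pre (Suc j) x c = mat_vec N (U j) (mat_vec N (query_op n k m x) (pre j x)) c"
        using U(3)[OF that(1) x that(2)] by simp
      then show ?thesis by (simp add: err_def[abs_def] \<psi>Suc mat_vec_diff)
    qed
    \<comment> \<open>Queries and all \<open>U j\<close> are isometries, so the initial error
      neither grows nor shrinks.\<close>
    have err: "ip N (err j) (err j) = ip N (err 0) (err 0)" if "j \<le> K" for j
      using that
    proof (induction j)
      case (Suc j)
      have "ip N (err (Suc j)) (err (Suc j)) = ip N (mat_vec N (U j) (mat_vec N (query_op n k m x) (err j)))
        (mat_vec N (U j) (mat_vec N (query_op n k m x) (err j)))"
        using Suc.prems by (intro ip_cong errSuc) auto
      also have "\<dots> = ip N (err j) (err j)"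
        using Suc.prems U(2) query_op_isometry[of n x k m] xk x by (simp add: N_def)
      finally show ?case using Suc by simp
    qed simp
    \<comment> \<open>The bare catalyst: up to sign it is the initial error, and its squared norm is
      at most W / K.\<close>
    define cat where "cat = vec k m (alg_state d (va x) (vb x) (\<lambda>_. 0) (neg x) 0 0 (leaf x))"
    have "err 0 c = 0 - cat c" if "c < N" for c
      using that unfolding N_def
    proof (rule idx_exhaust)
      fix i b w assume c: "i < n" "b < k" "w < m" "c = idx k m i b w"
      have "t 0 = 0" by (simp add: t_def)
      then show ?thesis
        unfolding err_def \<psi>0[OF that] unfolding c(4) start_def pre_def cat_def
        using c by (simp add: vec_idx alg_state_def)
    qed
    then have "ip N (err 0) (err 0) = ip N (\<lambda>c. 0 - cat c) (\<lambda>c. 0 - cat c)"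
      by (intro ip_cong) auto
    also have "\<dots> = ip N cat cat" by (simp add: ip_def)
    also have "\<dots> = (\<Sum>i<n. A i x x / of_nat K + B i x x / of_nat K)"
      unfolding cat_def N_def m_def
      using nk L x neg_less by (subst ip_alg_state) (auto simp: ip_va ip_vb)
    finally have "ip N (err K) (err K) = (\<Sum>i<n. (A i x x + B i x x)) / of_nat K"
      using err[of K] by (simp add: add_divide_distrib sum_divide_distrib)
    then have "Re (ip N (err K) (err K)) = (\<Sum>i<n. Re (A i x x + B i x x)) / K"
      by (simp add: Re_divide_of_nat)
    also have "\<dots> \<le> W / K" using W[OF x] by (intro divide_right_mono) auto
    also have "\<dots> \<le> 1 / 30" using K by (simp add: field_simps)
    finally have errK: "(\<Sum>c<N. (cmod (err K c))\<^sup>2) \<le> 1 / 30"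
      unfolding ip_self by simp
    define h where "h = d + d + 1 + leaf x"
    have h: "h < m" using L[OF x] by (simp add: h_def m_def)
    \<comment> \<open>The basis states that show the leaf of \<open>x\<close>, one per symbol. At j
      = K the ideal state has squared amplitude 1/k on each, so their total is 1; the ideal state is
      not normalised, as the catalyst comes on top.\<close>
    define S where "S = (\<lambda>b. idx k m 0 b h) ` {..<k}"
    have inj: "inj_on (\<lambda>b. idx k m 0 b h) {..<k}"
      using h by (intro inj_onI) (metis idx_decode(2) lessThan_iff)
    have SN: "S \<subseteq> {..<N}" using nk h by (auto simp: S_def N_def intro: idx_less)
    have pre_S: "(cmod (pre K x c))\<^sup>2 = 1 / k" if "c \<in> S" for c
      using that h K by (auto simp: S_def pre_def vec_idx) (auto simp: alg_state_def h_def t_def)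
    have "(\<Sum>c\<in>S. (cmod (pre K x c))\<^sup>2) = (\<Sum>c\<in>S. 1 / k)"
      by (rule sum.cong) (auto simp: pre_S)
    also have "\<dots> = 1" using nk card_image[OF inj] by (simp add: S_def)
    finally have pre1: "(\<Sum>c\<in>S. (cmod (pre K x c))\<^sup>2) = 1" .
    have "(\<Sum>c\<in>S. (cmod (err K c))\<^sup>2) \<le> (\<Sum>c<N. (cmod (err K c))\<^sup>2)"
      using SN by (intro sum_mono2) auto
    then have "2 / 3 \<le> 5 / 6 * (\<Sum>c\<in>S. (cmod (pre K x c))\<^sup>2) - 5 * (\<Sum>c\<in>S. (cmod (err K c))\<^sup>2)"
      using errK pre1 by simp
    also have "\<dots> = (\<Sum>c\<in>S. 5 / 6 * (cmod (pre K x c))\<^sup>2 - 5 * (cmod (err K c))\<^sup>2)"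
      by (simp add: sum_distrib_left sum_subtractf)
    also have "\<dots> \<le> (\<Sum>c\<in>S. (cmod (pre K x c + err K c))\<^sup>2)"
      by (intro sum_mono norm_add_sq_ge)
    also have "\<dots> = (\<Sum>c\<in>S. (cmod (\<psi> K c))\<^sup>2)"
      by (simp add: err_def)
    also have "\<dots> \<le> (\<Sum>c | c < N \<and> g c = f x. (cmod (\<psi> K c))\<^sup>2)"
    proof (intro sum_mono2)
      show "S \<subseteq> {c. c < N \<and> g c = f x}"
      proof
        fix c assume c: "c \<in> S"
        then have "c mod m = h" using h by (auto simp: S_def idx_decode)
        then show "c \<in> {c. c < N \<and> g c = f x}" using SN c g[OF x] by (auto simp: h_def)
      qed
    qed auto
    finally show ?thesis by (simp add: success_prob_def Let_def N_def \<psi>_def)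
  qed
  moreover have "length (Us K) = K + 1" "\<forall>V\<in>set (Us K). unitary (n * k * m) V" "1 \<le> m"
    using U0(1) U(1) m0 by (auto simp: Us_def N_def)
  ultimately show ?thesis unfolding quantum_computes_def by blast
qed

text \<open>Rounding 30 * w_r up costs at most 1, absorbed into 31 * w_r when w_r is at least 1. For
  smaller w_r the function is constant on \<open>D\<close> and no query is made.\<close>

lemma quantum_computes_tree:
  assumes "1 \<le> n" "1 \<le> k" "D \<subseteq> inputs n k" "wf_tree n k T" "computes T D f" "weighting_scheme T w"
  shows "\<exists>t. quantum_computes n k D f t \<and> real t \<le> 31 * w []"
proof -
  have finD: "finite D" using assms(3) finite_inputs by (rule finite_subset)
  have ev: "eval_tree T x = Some (f x)" if "x \<in> D" for x
    using assms(5) that by (simp add: computes_def)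
  then have "\<forall>x\<in>D. eval_tree T x \<noteq> None" by simp
  from tree_kernels[OF assms(4,6) finD this] obtain A B and leaf :: "nat list \<Rightarrow> nat"
    where A: "\<And>i. psd_on D (A i)" and B: "\<And>i. psd_on D (B i)"
      and leaf: "\<And>x y. x \<in> D \<Longrightarrow> y \<in> D \<Longrightarrow> leaf x = leaf y \<Longrightarrow> eval_tree T x = eval_tree T y"
      and AB: "\<And>x y. x \<in> D \<Longrightarrow> y \<in> D \<Longrightarrow>
        (\<Sum>i<n. if x ! i = y ! i then 0 else A i x y - B i x y) = (if leaf x = leaf y then 0 else 1)"
      and W: "\<And>x. x \<in> D \<Longrightarrow> (\<Sum>i<n. Re (A i x x + B i x x)) \<le> w []"
    by blast
  have leaf_f: "f x = f y" if "x \<in> D" "y \<in> D" "leaf x = leaf y" for x y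
    using leaf[OF that] ev that by simp
  show ?thesis
  proof (cases "w [] < 1")
    case True
    \<comment> \<open>Inputs at different leaves make the masked sum of A - B equal to 1, yet
      positivity bounds it by the mean of the two diagonal sums, hence by
      \<open>w []\<close>.\<close>
    have "leaf x = leaf y" if xy: "x \<in> D" "y \<in> D" for x y
    proof (rule ccontr)
      assume ne: "leaf x \<noteq> leaf y"
      then have "x \<noteq> y" by auto
      have "Re (if x ! i = y ! i then 0 else A i x y - B i x y) \<le>
        (Re (A i x x + B i x x) + Re (A i y y + B i y y)) / 2" for i
      proof -
        \<comment> \<open>The test vectors (1, -1) for \<open>A\<close> and (1, 1) for
          \<open>B\<close> give the two signs needed.\<close>
        have "2 * Re (A i x y) \<le> Re (A i x x) + Re (A i y y)"
          using psd_on_two[OF A finD xy \<open>x \<noteq> y\<close>, of 1 i "-1"] psd_on_cnj[OF A xy, of i] by simp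
        moreover have "- 2 * Re (B i x y) \<le> Re (B i x x) + Re (B i y y)"
          using psd_on_two[OF B finD xy \<open>x \<noteq> y\<close>, of 1 i 1] psd_on_cnj[OF B xy, of i] by simp
        moreover have "0 \<le> Re (A i x x)" "0 \<le> Re (A i y y)" "0 \<le> Re (B i x x)" "0 \<le> Re (B i y y)"
          using psd_on_diag(2)[OF A finD] psd_on_diag(2)[OF B finD] xy by auto
        ultimately show ?thesis by auto
      qed
      then have "(\<Sum>i<n. Re (if x ! i = y ! i then 0 else A i x y - B i x y)) \<le>
        (\<Sum>i<n. (Re (A i x x + B i x x) + Re (A i y y + B i y y)) / 2)"
        by (rule sum_mono)
      also have "\<dots> = ((\<Sum>i<n. Re (A i x x + B i x x)) + (\<Sum>i<n. Re (A i y y + B i y y))) / 2"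
        by (simp only: sum.distrib[symmetric] sum_divide_distrib[symmetric])
      also have "\<dots> \<le> w []" using W[OF xy(1)] W[OF xy(2)] by simp
      also have "(\<Sum>i<n. Re (if x ! i = y ! i then 0 else A i x y - B i x y)) = 1"
        unfolding Re_sum[symmetric] AB[OF xy] using ne by simp
      finally show False using True by simp
    qed
    then have "quantum_computes n k D f 0"
      by (intro quantum_computes_constant assms(1,2) leaf_f)
    moreover have "0 \<le> w []"
    proof -
      have "subtree T [] \<noteq> None" by simp
      then show ?thesis using assms(6) unfolding weighting_scheme_def by blast
    qed
    ultimately show ?thesis by (intro exI[of _ 0]) simp
  next
    case False
    define K where "K = nat \<lceil>30 * w []\<rceil>"
    have K: "30 * w [] \<le> real K" "real K \<le> 30 * w [] + 1" "1 \<le> K"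
      using False unfolding K_def by linarith+
    have "quantum_computes n k D f K"
      using assms(1-3) A B leaf_f AB W K(3,1) by (rule quantum_computes_kernels)
    then show ?thesis using K False by (intro exI[of _ K]) simp
  qed
qed

section \<open>Comparison with the weighted decision tree complexity\<close>

lemma subtree_append: "subtree T p = Some t \<Longrightarrow> subtree T (p @ q) = subtree t q"
  by (induction T p rule: subtree.induct) (auto split: option.splits)

text \<open>The weight is \<open>size\<close> of the subtree: 0 at leaves and falling by at least 1
  along each edge, which pays for X the all-ones matrix and Y = 0.\<close>

lemma ex_weighting_scheme: "\<exists>w. weighting_scheme T w"
proof
  let ?w = "\<lambda>p. case subtree T p of None \<Rightarrow> 0 | Some t \<Rightarrow> real (size t)"
  have one: "psd m (\<lambda>_ _. 1)" for m
    unfolding psd_def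
  proof (intro conjI allI impI)
    fix v :: "nat \<Rightarrow> complex"
    have "(\<Sum>i<m. \<Sum>j<m. cnj (v i) * 1 * v j) = cnj (\<Sum>i<m. v i) * (\<Sum>i<m. v i)"
      by (simp add: sum_product)
    moreover have "0 \<le> Re (cnj a * a)" for a by simp
    ultimately show "0 \<le> Re (\<Sum>i<m. \<Sum>j<m. cnj (v i) * 1 * v j)" by (simp only:)
  qed auto
  have zero: "psd m (\<lambda>_ _. 0)" for m by (simp add: psd_def)
  have step: "?w p - ?w (p @ [fst (cs ! j)]) \<ge> Re (1 + 0)"
    if "subtree T p = Some (Node i cs)" "j < length cs" for p i cs j
  proof -
    have "fst (cs ! j) \<in> fst ` set cs" using that(2) by simp
    then obtain c where c: "map_of cs (fst (cs ! j)) = Some c"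
      by (metis map_of_eq_None_iff not_None_eq)
    then show ?thesis using map_of_size_dtree[OF c] subtree_append[OF that(1)] that(1) by simp
  qed
  show "weighting_scheme T ?w"
    unfolding weighting_scheme_def
  proof (intro conjI allI impI)
    fix p i cs assume p: "subtree T p = Some (Node i cs)"
    show "\<exists>X Y. psd (length cs) X \<and> psd (length cs) Y \<and>
      (\<forall>j1<length cs. \<forall>j2<length cs. j1 \<noteq> j2 \<longrightarrow> X j1 j2 - Y j1 j2 = 1) \<and>
      (\<forall>j<length cs. ?w p - ?w (p @ [fst (cs ! j)]) \<ge> Re (X j j + Y j j))"
      by (rule exI[of _ "\<lambda>_ _. 1"], rule exI[of _ "\<lambda>_ _. 0"], intro conjI allI impI one zero step[OF p])
        simp_all
  qed (auto split: option.splits)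
qed

text \<open>The brute-force tree that reads the whole input in order: \<open>xs\<close> is the
  prefix read, \<open>r\<close> the number of symbols to come.\<close>

fun full_tree :: "nat \<Rightarrow> (nat list \<Rightarrow> nat) \<Rightarrow> nat \<Rightarrow> nat list \<Rightarrow> dtree" where
  "full_tree k f 0 xs = Leaf (f xs)"
| "full_tree k f (Suc r) xs = Node (length xs) (map (\<lambda>a. (a, full_tree k f r (xs @ [a]))) [0..<k])"

lemma wf_full_tree: "length xs + r \<le> n \<Longrightarrow> wf_tree n k (full_tree k f r xs)"
  by (induction r arbitrary: xs) (auto simp: comp_def)

lemma eval_full_tree:
  assumes "x \<in> inputs n k" "length xs + r = n" "take (length xs) x = xs"
  shows "eval_tree (full_tree k f r xs) x = Some (f x)"
  using assms(2,3)
proof (induction r arbitrary: xs)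
  case 0
  then show ?case using assms(1) by (simp add: inputs_def)
next
  case (Suc r)
  have l: "length xs < length x" using assms(1) Suc.prems by (auto simp: inputs_def)
  then have "x ! length xs < k" using assms(1) by (auto simp: inputs_def)
  moreover have "take (Suc (length xs)) x = xs @ [x ! length xs]"
    using l Suc.prems by (simp add: take_Suc_conv_app_nth)
  ultimately show ?case
    using Suc.IH[of "xs @ [x ! length xs]"] Suc.prems by (simp add: map_of_map_restrict)
qed

text \<open>Each tree and scheme bounds \<open>Q\<close>, and the bound passes to both infima. These
  range over nonempty sets, without which \<open>Inf\<close> on the reals would say nothing.\<close>

lemma Q_le_WDT:
  assumes "1 \<le> n" "1 \<le> k" "D \<subseteq> inputs n k"
  shows "real (Q n k D f) \<le> 31 * WDT n k D f"
proof -
  have "real (Q n k D f) / 31 \<le> WDT n k D f"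
    unfolding WDT_def
  proof (rule cInf_greatest)
    have "wf_tree n k (full_tree k f n [])" by (rule wf_full_tree) simp
    moreover have "computes (full_tree k f n []) D f"
      using assms(3) eval_full_tree[of _ n k "[]" n f] by (auto simp: computes_def)
    ultimately show "{WDT_tree T | T. wf_tree n k T \<and> computes T D f} \<noteq> {}" by blast
    fix y assume "y \<in> {WDT_tree T | T. wf_tree n k T \<and> computes T D f}"
    then obtain T where T: "wf_tree n k T" "computes T D f" and y: "y = WDT_tree T" by blast
    show "real (Q n k D f) / 31 \<le> y"
      unfolding y WDT_tree_def
    proof (rule cInf_greatest)
      show "{w [] |w. weighting_scheme T w} \<noteq> {}" using ex_weighting_scheme by blast
      fix z assume "z \<in> {w [] |w. weighting_scheme T w}"
      then obtain w where w: "weighting_scheme T w" "z = w []" by blast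
      obtain t where t: "quantum_computes n k D f t" "real t \<le> 31 * w []"
        using quantum_computes_tree[OF assms T w(1)] by blast
      have "Q n k D f \<le> t" unfolding Q_def using t(1) by (rule Least_le)
      then show "real (Q n k D f) / 31 \<le> z" using t(2) w(2) by simp
    qed
  qed
  then show ?thesis by simp
qed

theorem theorem6p2:
  "\<exists>C :: real. C > 0 \<and>
     (\<forall>n k D f T w. 1 \<le> n \<longrightarrow> 1 \<le> k \<longrightarrow> D \<subseteq> inputs n k \<longrightarrow>
        wf_tree n k T \<longrightarrow> computes T D f \<longrightarrow> weighting_scheme T w \<longrightarrow>
        (\<exists>t. quantum_computes n k D f t \<and> real t \<le> C * w [])) \<and>
     (\<forall>n k D f. 1 \<le> n \<longrightarrow> 1 \<le> k \<longrightarrow> D \<subseteq> inputs n k \<longrightarrow>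
        real (Q n k D f) \<le> C * WDT n k D f)"
  using quantum_computes_tree Q_le_WDT by (intro exI[of _ 31]) simp

end
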